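(* Every function in $\mathcal A_\infty$ has $B_\infty$-property.
   Context: A Nevanlinna function $m$ is holomorphic at least on $\mathbb C\setminus\mathbb R$, with $m(z^* )=m(z)^*$ ($z^*$ is the complex conjugate) and $\operatorname{Im}m(z)\ge0$ for $\operatorname{Im}z>0$; it is considered on its full domain of holomorphy (the union of $\mathbb C\setminus\mathbb R$ and the real points to which it continues holomorphically). It is a Stieltjes function if it is holomorphic on $\mathbb C\setminus[0,+\infty)$ and takes nonnegative values on $\mathbb R_-=(-\infty,0)$. Powers are principal: $z^\alpha=|z|^\alpha e^{i\alpha\operatorname{Arg}z}$, $\operatorname{Arg}z\in(-\pi,\pi)$; $f\sim g$ means $f/g\to1$. $\mathcal A_\infty$ is the set of Nevanlinna functions $m$ for which there are $\alpha\in(0,1)$, $C>0$ and a Möbius transformation $\mu(z)=\frac{az+b}{cz+d}$ with $a,b,c,d\in\mathbb R$, $ad-bc\in\{-1,1\}$, such that $\mu\circ m$ is a Stieltjes function and for all $z\in\mathbb C\setminus\mathbb R$: $(\mu\circ m)(rz)\sim C/(-rz)^\alpha$ as $r\to+\infty$. For a Nevanlinna function $m$, $\mathcal H(m)$ is the reproducing kernel Hilbert space of holomorphic functions on $\mathbb C\setminus\mathbb R$ with kernel $K_m(z,w)=\frac{m(z)-m(w)^*}{z-w^*}$ ($z\ne w^*$; extended by continuity). With $w_m(y)=1/\operatorname{Im}m(iy)$, $y>0$, $m$ has $B_\infty$-property if $h\mapsto\big(y\mapsto h(iy)\big)$ is a bounded operator from $\mathcal H(m)$ into the weighted space $L^2_{w_m}(1,\infty)$.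 *)

theory Defs
  imports "HOL-Complex_Analysis.Complex_Analysis" "HOL-Library.Landau_Symbols"
begin

text \<open>
  A Nevanlinna function is represented by a total function whose values off the real line are the
  only ones that matter; its values at real points of the full domain of holomorphy are determined
  by analytic continuation and are recovered where they are needed (see \<open>stieltjes\<close>).
\<close>

definition nevanlinna :: "(complex \<Rightarrow> complex) \<Rightarrow> bool" where
  "nevanlinna m \<longleftrightarrow>
     m holomorphic_on (- \<real>) \<and>
     (\<forall>z\<in>- \<real>. m (cnj z) = cnj (m z)) \<and>
     (\<forall>z. Im z > 0 \<longrightarrow> Im (m z) \<ge> 0)"

text \<open>
  \<open>g\<close> is the (unique) continuation of \<open>m\<close> across the negative half-line.
\<close>

definition stieltjes :: "(complex \<Rightarrow> complex) \<Rightarrow> bool" where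
  "stieltjes m \<longleftrightarrow>
     nevanlinna m \<and>
     (\<exists>g. g holomorphic_on (- \<real>\<^sub>\<ge>\<^sub>0) \<and> (\<forall>z\<in>- \<real>. g z = m z) \<and>
          (\<forall>x::real. x < 0 \<longrightarrow> g (of_real x) \<in> \<real>\<^sub>\<ge>\<^sub>0))"

definition moebius :: "real \<Rightarrow> real \<Rightarrow> real \<Rightarrow> real \<Rightarrow> complex \<Rightarrow> complex" where
  "moebius a b c d z = (of_real a * z + of_real b) / (of_real c * z + of_real d)"

text \<open>
  For nonreal \<open>z\<close> and Nevanlinna \<open>m\<close>, the denominator \<open>c * m z + d\<close> can vanish only if \<open>m\<close> is the
  real constant \<open>- d / c\<close>. The composition is then \<open>\<infinity>\<close> in the usual reading and 0 by the
  convention \<open>x / 0 = 0\<close>; in neither reading does it satisfy the asymptotic condition.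
\<close>

definition A_infty :: "(complex \<Rightarrow> complex) set" where
  "A_infty = {m. nevanlinna m \<and>
     (\<exists>\<alpha> C a b c d :: real.
        0 < \<alpha> \<and> \<alpha> < 1 \<and> C > 0 \<and> a * d - b * c \<in> {-1, 1} \<and>
        stieltjes (moebius a b c d \<circ> m) \<and>
        (\<forall>z\<in>- \<real>.
          (\<lambda>r::real. (moebius a b c d \<circ> m) (of_real r * z)) \<sim>[at_top]
          (\<lambda>r::real. of_real C / (- (of_real r * z)) powr of_real \<alpha>)))}"

definition nevanlinna_kernel :: "(complex \<Rightarrow> complex) \<Rightarrow> complex \<Rightarrow> complex \<Rightarrow> complex" where
  "nevanlinna_kernel m z w =
     (if z \<noteq> cnj w then (m z - cnj (m w)) / (z - cnj w)
      else Lim (at z) (\<lambda>\<zeta>. (m \<zeta> - cnj (m w)) / (\<zeta> - cnj w)))"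

text \<open>
  A reproducing kernel Hilbert space of complex-valued functions on \<open>X\<close>, given by its set \<open>H\<close> of
  elements and its inner product \<open>ip\<close>, which is linear in the first argument. A function on \<open>X\<close> is
  represented by its extension by 0, so that equality of elements of \<open>H\<close> is equality of total
  functions.
\<close>

locale rkhs =
  fixes X :: "'a set"
    and K :: "'a \<Rightarrow> 'a \<Rightarrow> complex"
    and H :: "('a \<Rightarrow> complex) set"
    and ip :: "('a \<Rightarrow> complex) \<Rightarrow> ('a \<Rightarrow> complex) \<Rightarrow> complex"
  assumes outside: "f \<in> H \<Longrightarrow> x \<notin> X \<Longrightarrow> f x = 0"
    and zero_mem: "(\<lambda>x. 0) \<in> H"
    and add_mem: "f \<in> H \<Longrightarrow> g \<in> H \<Longrightarrow> (\<lambda>x. f x + g x) \<in> H"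
    and scale_mem: "f \<in> H \<Longrightarrow> (\<lambda>x. a * f x) \<in> H"
    and ip_add: "f \<in> H \<Longrightarrow> g \<in> H \<Longrightarrow> k \<in> H \<Longrightarrow> ip (\<lambda>x. f x + g x) k = ip f k + ip g k"
    and ip_scale: "f \<in> H \<Longrightarrow> g \<in> H \<Longrightarrow> ip (\<lambda>x. a * f x) g = a * ip f g"
    and ip_cnj: "f \<in> H \<Longrightarrow> g \<in> H \<Longrightarrow> ip g f = cnj (ip f g)"
    and ip_nonneg: "f \<in> H \<Longrightarrow> ip f f \<in> \<real>\<^sub>\<ge>\<^sub>0"
    and ip_definite: "f \<in> H \<Longrightarrow> ip f f = 0 \<Longrightarrow> f = (\<lambda>x. 0)"
    and complete:
      "(\<And>n. F n \<in> H) \<Longrightarrow>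
       (\<And>\<epsilon>. \<epsilon> > 0 \<Longrightarrow> \<exists>N. \<forall>i\<ge>N. \<forall>j\<ge>N.
          sqrt (Re (ip (\<lambda>x. F i x - F j x) (\<lambda>x. F i x - F j x))) < \<epsilon>) \<Longrightarrow>
       \<exists>f\<in>H. (\<lambda>n. sqrt (Re (ip (\<lambda>x. F n x - f x) (\<lambda>x. F n x - f x)))) \<longlonglongrightarrow> 0"
    and kernel_mem: "y \<in> X \<Longrightarrow> (\<lambda>x. if x \<in> X then K x y else 0) \<in> H"
    and reproducing:
      "f \<in> H \<Longrightarrow> y \<in> X \<Longrightarrow> f y = ip f (\<lambda>x. if x \<in> X then K x y else 0)"

definition nevanlinna_space ::
  "(complex \<Rightarrow> complex) \<Rightarrow> (complex \<Rightarrow> complex) set \<Rightarrow>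
   ((complex \<Rightarrow> complex) \<Rightarrow> (complex \<Rightarrow> complex) \<Rightarrow> complex) \<Rightarrow> bool" where
  "nevanlinna_space m H ip \<longleftrightarrow>
     rkhs (- \<real>) (nevanlinna_kernel m) H ip \<and> (\<forall>h\<in>H. h holomorphic_on (- \<real>))"

definition L2_weighted :: "(real \<Rightarrow> real) \<Rightarrow> real set \<Rightarrow> (real \<Rightarrow> complex) set" where
  "L2_weighted w I = {f. set_borel_measurable lborel I f \<and>
     set_integrable lborel I (\<lambda>y. (cmod (f y))\<^sup>2 * w y)}"

definition L2_weighted_norm :: "(real \<Rightarrow> real) \<Rightarrow> real set \<Rightarrow> (real \<Rightarrow> complex) \<Rightarrow> real" where
  "L2_weighted_norm w I f = sqrt (set_lebesgue_integral lborel I (\<lambda>y. (cmod (f y))\<^sup>2 * w y))"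

definition B_weight :: "(complex \<Rightarrow> complex) \<Rightarrow> real \<Rightarrow> real" where
  "B_weight m y = 1 / Im (m (\<i> * of_real y))"

text \<open>
  The reproducing kernel Hilbert space of \<open>m\<close> exists and is unique (Moore and Aronszajn; the kernel of
  a Nevanlinna function is positive semidefinite), so quantifying over all pairs \<open>(H, ip)\<close> with
  \<open>nevanlinna_space m H ip\<close> is speaking of this one space. Linearity of
  \<open>h \<mapsto> (\<lambda>y. h (\<i> * y))\<close> is evident, so boundedness amounts to the norm estimate.
\<close>

definition has_B_infty_property :: "(complex \<Rightarrow> complex) \<Rightarrow> bool" where
  "has_B_infty_property m \<longleftrightarrow>
     (\<forall>H ip. nevanlinna_space m H ip \<longrightarrow>
       (\<exists>M. \<forall>h\<in>H.
          (\<lambda>y. h (\<i> * of_real y)) \<in> L2_weighted (B_weight m) {1<..} \<and>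
          L2_weighted_norm (B_weight m) {1<..} (\<lambda>y. h (\<i> * of_real y))
            \<le> M * sqrt (Re (ip h h))))"

end

theory Submission
  imports Defs
begin

text \<open>
  If \<open>T\<close> is the restriction of \<open>\<H>(m)\<close> to the imaginary axis, \<open>T T\<^sup>*\<close> is the integral
  operator with kernel \<open>K\<^sub>m(i x, i y)\<close>, so boundedness of \<open>T\<close> can be read off from the size of
  this kernel by Schur's test. After symmetrising with respect to the weight the kernel is, in modulus,
  \<open>1 / (x + y)\<close> times \<open>q(m(i x), m(i y))\<close>, where
  \<open>q(u, v) = \<bar>u - cnj v\<bar> / sqrt (Im u * Im v)\<close>.

  The quantity \<open>q(u, v)\<close> depends only on the hyperbolic distance of \<open>u\<close> and \<open>v\<close> in the upper
  half-plane (\<open>q = 2 cosh (d / 2)\<close>), hence it does not change if \<open>m\<close> is replaced by \<open>\<mu> \<circ> m\<close> with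
  a real Moebius transformation \<open>\<mu>\<close> of determinant 1 (lemma \<open>moebius_invariant_ratio\<close>). The
  determinant cannot be \<open>-1\<close> because \<open>\<mu>\<close> would then interchange the half-planes. On the imaginary
  axis \<open>\<mu> \<circ> m\<close> behaves like \<open>C y\<^sup>-\<^sup>\<alpha> e\<^sup>i\<^sup>\<alpha>\<^sup>\<pi>\<^sup>/\<^sup>2\<close>, whose argument stays away from \<open>0\<close>, so modulus
  and imaginary part are both comparable to \<open>y\<^sup>-\<^sup>\<alpha>\<close>. The symmetrised kernel is therefore dominated
  by a multiple of \<open>((x / y)\<^sup>\<alpha>\<^sup>/\<^sup>2 + (y / x)\<^sup>\<alpha>\<^sup>/\<^sup>2) / (x + y)\<close>. This is homogeneous of degree \<open>-1\<close>,
  and \<open>\<alpha> < 1\<close> makes it decay away from the diagonal fast enough for Schur's test.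

  The adjoint \<open>T\<^sup>*\<close> would call for integrals with values in \<open>\<H>(m)\<close>. To avoid them, the test is
  applied to point evaluations at the finitely many points \<open>i 2\<^sup>k t\<close>, \<open>k < N\<close>, with masses \<open>2\<^sup>k t\<close>
  (lemma \<open>sampling_bound_schur\<close>); on such a sequence the kernel is dominated by a geometric
  Toeplitz matrix \<open>\<rho>\<^bsup>|j - k|\<^esup>\<close>, uniformly in \<open>t\<close> and \<open>N\<close> (lemma \<open>dyadic_row_sums_bounded\<close>). The
  integral over the half-line is an integral over \<open>t \<in> [1, 2)\<close> of these dyadic sums
  (lemma \<open>nn_integral_dyadic\<close>), so the estimate passes to \<open>L\<^sup>2\<close>.
\<close>

section \<open>Sampling in a reproducing kernel Hilbert space\<close>

context rkhs
begin

abbreviation kernel_function :: "'a \<Rightarrow> 'a \<Rightarrow> complex" where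
  "kernel_function y \<equiv> (\<lambda>x. if x \<in> X then K x y else 0)"

lemma ip_add_right:
  assumes "f \<in> H" "g \<in> H" "k \<in> H"
  shows "ip k (\<lambda>x. f x + g x) = ip k f + ip k g"
proof -
  have "ip k (\<lambda>x. f x + g x) = cnj (ip (\<lambda>x. f x + g x) k)"
    using assms by (intro ip_cnj add_mem)
  also have "\<dots> = cnj (ip f k) + cnj (ip g k)"
    using assms by (simp add: ip_add)
  also have "\<dots> = ip k f + ip k g"
    using assms by (simp add: ip_cnj[symmetric])
  finally show ?thesis .
qed

lemma ip_scale_right:
  assumes "f \<in> H" "k \<in> H"
  shows "ip k (\<lambda>x. a * f x) = cnj a * ip k f"
proof -
  have "ip k (\<lambda>x. a * f x) = cnj (ip (\<lambda>x. a * f x) k)"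
    using assms by (intro ip_cnj scale_mem)
  also have "\<dots> = cnj a * cnj (ip f k)"
    using assms by (simp add: ip_scale)
  also have "\<dots> = cnj a * ip k f"
    using assms by (simp add: ip_cnj[symmetric])
  finally show ?thesis .
qed

lemma ip_zero_right: "k \<in> H \<Longrightarrow> ip k (\<lambda>x. 0) = 0"
  using ip_scale_right[OF zero_mem, of k 0] by simp

lemma ip_self_eq_Re: "f \<in> H \<Longrightarrow> ip f f = of_real (Re (ip f f))"
  using ip_nonneg[of f] by (metis complex_nonneg_Reals_iff complex_is_Real_iff of_real_Re)

lemma Re_ip_self_nonneg: "f \<in> H \<Longrightarrow> 0 \<le> Re (ip f f)"
  using ip_nonneg[of f] by (simp add: complex_nonneg_Reals_iff)

text \<open>
  The inequality says that the squared norm of \<open>f - (ip f g / ip g g) g\<close> is nonnegative.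
\<close>

lemma cauchy_schwarz:
  assumes f: "f \<in> H" and g: "g \<in> H"
  shows "(cmod (ip f g))\<^sup>2 \<le> Re (ip f f) * Re (ip g g)"
proof (cases "ip g g = 0")
  case True
  then show ?thesis using ip_definite[OF g] ip_zero_right[OF f] by simp
next
  case False
  define G where "G = Re (ip g g)"
  have ipgg: "ip g g = of_real G" using ip_self_eq_Re[OF g] by (simp add: G_def)
  have "G \<noteq> 0" using False ipgg by auto
  moreover have "G \<ge> 0" using Re_ip_self_nonneg[OF g] by (simp only: G_def)
  ultimately have G: "G > 0" by simp
  define t where "t = - (ip f g / of_real G)"
  have tg: "(\<lambda>x. t * g x) \<in> H" using g by (rule scale_mem)
  have gf: "ip g f = cnj (ip f g)" using f g by (rule ip_cnj)
  have "ip (\<lambda>x. f x + t * g x) (\<lambda>x. f x + t * g x)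
      = ip f f + cnj t * ip f g + t * (ip g f + cnj t * ip g g)"
    using f g tg by (simp add: ip_add ip_add_right ip_scale ip_scale_right add_mem algebra_simps)
  also have "\<dots> = ip f f - ip f g * cnj (ip f g) / of_real G"
    using G by (simp add: t_def gf ipgg field_simps)
  also have "\<dots> = of_real (Re (ip f f) - (cmod (ip f g))\<^sup>2 / G)"
    unfolding complex_norm_square[symmetric] by (subst ip_self_eq_Re[OF f]) simp
  finally have "0 \<le> Re (ip f f) - (cmod (ip f g))\<^sup>2 / G"
    using Re_ip_self_nonneg[OF add_mem[OF f tg]] by simp
  then show ?thesis using G by (simp add: field_simps G_def)
qed

text \<open>
  Finite combinations of kernel functions represent the functionals that combine finitely many
  point evaluations.
\<close>

lemma kernel_combination:
  assumes "finite I" "\<And>i. i \<in> I \<Longrightarrow> p i \<in> X"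
  shows "(\<lambda>x. \<Sum>i\<in>I. a i * kernel_function (p i) x) \<in> H \<and>
    (\<forall>f\<in>H. ip f (\<lambda>x. \<Sum>i\<in>I. a i * kernel_function (p i) x) = (\<Sum>i\<in>I. cnj (a i) * f (p i)))"
  using assms
proof (induction I rule: finite_induct)
  case empty
  then show ?case by (simp add: zero_mem ip_zero_right)
next
  case (insert j I)
  let ?k = "\<lambda>x. a j * kernel_function (p j) x"
  let ?s = "\<lambda>x. \<Sum>i\<in>I. a i * kernel_function (p i) x"
  have k: "kernel_function (p j) \<in> H" using insert.prems by (intro kernel_mem) auto
  have aK: "?k \<in> H" by (rule scale_mem[OF k])
  have s: "?s \<in> H" and ips: "\<And>f. f \<in> H \<Longrightarrow> ip f ?s = (\<Sum>i\<in>I. cnj (a i) * f (p i))"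
    using insert.IH insert.prems by auto
  have split: "(\<lambda>x. \<Sum>i\<in>insert j I. a i * kernel_function (p i) x) = (\<lambda>x. ?k x + ?s x)"
    using insert.hyps by simp
  have "ip f (\<lambda>x. ?k x + ?s x) = cnj (a j) * f (p j) + (\<Sum>i\<in>I. cnj (a i) * f (p i))"
    if f: "f \<in> H" for f
  proof -
    have "ip f ?k = cnj (a j) * f (p j)"
      using reproducing[OF f, of "p j"] insert.prems ip_scale_right[OF k f] by simp
    then show ?thesis using ip_add_right[OF aK s f] ips[OF f] by simp
  qed
  then show ?case
    unfolding split using add_mem[OF aK s] insert.hyps by simp
qed

lemma kernel_hermitian:
  assumes "x \<in> X" "y \<in> X"
  shows "K y x = cnj (K x y)"
proof -
  have "K y x = ip (kernel_function x) (kernel_function y)"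
    using reproducing[OF kernel_mem[OF assms(1)] assms(2)] assms by simp
  also have "\<dots> = cnj (ip (kernel_function y) (kernel_function x))"
    using assms by (intro ip_cnj kernel_mem)
  also have "ip (kernel_function y) (kernel_function x) = K x y"
    using reproducing[OF kernel_mem[OF assms(2)] assms(1)] assms by simp
  finally show ?thesis .
qed

text \<open>
  Schur's test for the sampling map \<open>f \<mapsto> (sqrt (w\<^sub>i) f(p\<^sub>i))\<^sub>i\<close>. Its composition with its adjoint is the
  Hermitian matrix with entries \<open>sqrt (w\<^sub>i w\<^sub>j) K(p\<^sub>i, p\<^sub>j)\<close>, whose norm is at most its largest absolute
  row sum. The proof pairs \<open>f\<close> with the element \<open>g = \<Sum>\<^sub>i w\<^sub>i f(p\<^sub>i) K(\<cdot>, p\<^sub>i)\<close>: then \<open>ip f g\<close> is the left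
  side \<open>T\<close>, and the row sum bound gives \<open>ip g g \<le> S T\<close>, so that Cauchy--Schwarz yields
  \<open>T\<^sup>2 \<le> (ip f f) S T\<close>.
\<close>

lemma sampling_bound_schur:
  assumes I: "finite I" and p: "\<And>i. i \<in> I \<Longrightarrow> p i \<in> X"
    and w: "\<And>i. i \<in> I \<Longrightarrow> 0 \<le> w i"
    and row: "\<And>i. i \<in> I \<Longrightarrow> (\<Sum>j\<in>I. sqrt (w i * w j) * cmod (K (p i) (p j))) \<le> S"
    and S: "0 \<le> S"
    and f: "f \<in> H"
  shows "(\<Sum>i\<in>I. w i * (cmod (f (p i)))\<^sup>2) \<le> S * Re (ip f f)"
proof -
  define T where "T = (\<Sum>i\<in>I. w i * (cmod (f (p i)))\<^sup>2)"
  define b where "b i = sqrt (w i) * cmod (f (p i))" for i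
  define Q where "Q i j = sqrt (w i * w j) * cmod (K (p i) (p j))" for i j
  define a where "a i = of_real (w i) * f (p i)" for i
  define g where "g = (\<lambda>x. \<Sum>i\<in>I. a i * kernel_function (p i) x)"
  have g: "g \<in> H" and ipg: "\<And>h. h \<in> H \<Longrightarrow> ip h g = (\<Sum>i\<in>I. cnj (a i) * h (p i))"
    using kernel_combination[of I p a, OF I p] by (auto simp: g_def)
  have b2: "(b i)\<^sup>2 = w i * (cmod (f (p i)))\<^sup>2" if "i \<in> I" for i
    using w[OF that] by (simp add: b_def power_mult_distrib)
  have T0: "T \<ge> 0" unfolding T_def using w by (intro sum_nonneg) auto
  have Q0: "Q i j \<ge> 0" if "i \<in> I" "j \<in> I" for i j
    using w that by (simp add: Q_def)
  have Qsym: "Q i j = Q j i" if "i \<in> I" "j \<in> I" for i j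
    using kernel_hermitian[OF p[OF that(1)] p[OF that(2)]] by (simp add: Q_def mult.commute)
  have "ip f g = (\<Sum>i\<in>I. of_real (w i * (cmod (f (p i)))\<^sup>2))"
    unfolding ipg[OF f] a_def of_real_mult complex_norm_square
    by (intro sum.cong refl) (simp add: mult_ac)
  then have fg: "ip f g = of_real T" by (simp add: T_def)
  have gp: "g (p i) = (\<Sum>j\<in>I. a j * K (p i) (p j))" if "i \<in> I" for i
    using p[OF that] by (simp add: g_def)
  have ipgg: "ip g g = (\<Sum>i\<in>I. \<Sum>j\<in>I. cnj (a i) * a j * K (p i) (p j))"
    unfolding ipg[OF g] by (intro sum.cong refl) (simp add: gp sum_distrib_left mult.assoc)
  have "Re (ip g g) \<le> cmod (ip g g)" by (rule complex_Re_le_cmod)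
  also have "\<dots> \<le> (\<Sum>i\<in>I. \<Sum>j\<in>I. cmod (cnj (a i) * a j * K (p i) (p j)))"
    unfolding ipgg by (intro order_trans[OF norm_sum] sum_mono norm_sum)
  also have "\<dots> = (\<Sum>i\<in>I. \<Sum>j\<in>I. b i * b j * Q i j)"
  proof (intro sum.cong refl)
    fix i j assume ij: "i \<in> I" "j \<in> I"
    have "w i = sqrt (w i) * sqrt (w i)" "w j = sqrt (w j) * sqrt (w j)"
      using w ij by auto
    then show "cmod (cnj (a i) * a j * K (p i) (p j)) = b i * b j * Q i j"
      using w[OF ij(1)] w[OF ij(2)]
      by (simp add: a_def b_def Q_def norm_mult real_sqrt_mult mult_ac)
  qed
  also have "\<dots> \<le> (\<Sum>i\<in>I. \<Sum>j\<in>I. ((b i)\<^sup>2 / 2 * Q i j + (b j)\<^sup>2 / 2 * Q j i))"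
  proof (intro sum_mono)
    fix i j assume ij: "i \<in> I" "j \<in> I"
    have "b i * b j \<le> (b i)\<^sup>2 / 2 + (b j)\<^sup>2 / 2"
      using sum_squares_bound[of "b i" "b j"] by simp
    then have "b i * b j * Q i j \<le> ((b i)\<^sup>2 / 2 + (b j)\<^sup>2 / 2) * Q i j"
      using Q0[OF ij] by (intro mult_right_mono) auto
    then show "b i * b j * Q i j \<le> (b i)\<^sup>2 / 2 * Q i j + (b j)\<^sup>2 / 2 * Q j i"
      using Qsym[OF ij] by (simp add: algebra_simps)
  qed
  also have "\<dots> = (\<Sum>i\<in>I. \<Sum>j\<in>I. (b i)\<^sup>2 / 2 * Q i j) + (\<Sum>i\<in>I. \<Sum>j\<in>I. (b j)\<^sup>2 / 2 * Q j i)"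
    by (simp add: sum.distrib)
  also have "(\<Sum>i\<in>I. \<Sum>j\<in>I. (b j)\<^sup>2 / 2 * Q j i) = (\<Sum>i\<in>I. \<Sum>j\<in>I. (b i)\<^sup>2 / 2 * Q i j)"
    by (rule sum.swap)
  also have "(\<Sum>i\<in>I. \<Sum>j\<in>I. (b i)\<^sup>2 / 2 * Q i j) + (\<Sum>i\<in>I. \<Sum>j\<in>I. (b i)\<^sup>2 / 2 * Q i j)
      = (\<Sum>i\<in>I. (b i)\<^sup>2 * (\<Sum>j\<in>I. Q i j))"
    unfolding sum.distrib[symmetric] sum_distrib_left by (intro sum.cong refl) simp
  also have "\<dots> \<le> (\<Sum>i\<in>I. (b i)\<^sup>2 * S)"
    using row by (intro sum_mono mult_left_mono) (auto simp: Q_def)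
  also have "\<dots> = T * S"
    unfolding T_def sum_distrib_right by (intro sum.cong refl) (simp add: b2)
  finally have gg: "Re (ip g g) \<le> T * S" .
  have "T\<^sup>2 \<le> Re (ip f f) * Re (ip g g)"
    using cauchy_schwarz[OF f g] by (simp add: fg)
  also have "\<dots> \<le> Re (ip f f) * (T * S)"
    using gg Re_ip_self_nonneg[OF f] by (intro mult_left_mono)
  finally have "T * T \<le> T * (S * Re (ip f f))"
    by (simp add: power2_eq_square mult_ac)
  moreover have "0 \<le> S * Re (ip f f)"
    using S Re_ip_self_nonneg[OF f] by simp
  ultimately show ?thesis
    using T0 unfolding T_def[symmetric] by (cases "T = 0") auto
qed

end

section \<open>Integrals over a half-line as averages of dyadic sums\<close>

text \<open>
  The intervals \<open>[2\<^sup>k, 2\<^sup>k\<^sup>+\<^sup>1)\<close> partition \<open>[1, \<infinity>)\<close>, and \<open>x = 2\<^sup>k t\<close> carries \<open>[1, 2)\<close> onto each of them.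
\<close>

lemma nn_integral_dyadic:
  fixes f :: "real \<Rightarrow> ennreal"
  assumes [measurable]: "f \<in> borel_measurable borel"
  shows "(\<integral>\<^sup>+x\<in>{1..}. f x \<partial>lborel) = (\<integral>\<^sup>+t\<in>{1..<2}. (\<Sum>k. 2 ^ k * f (2 ^ k * t)) \<partial>lborel)"
proof -
  define B :: "nat \<Rightarrow> real set" where "B k = {2 ^ k..<2 ^ Suc k}" for k
  have cover: "{1..} = (\<Union>k. B k)"
  proof (intro equalityI subsetI)
    fix x :: real assume x: "x \<in> {1..}"
    define k where "k = (LEAST k. x < 2 ^ Suc k)"
    have "\<exists>k. x < 2 ^ Suc k"
    proof -
      obtain n where "x < 2 ^ n" using real_arch_pow[of 2 x] by auto
      also have "(2::real) ^ n \<le> 2 ^ Suc n" by simp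
      finally show ?thesis ..
    qed
    then have 1: "x < 2 ^ Suc k" unfolding k_def by (rule LeastI_ex)
    have "2 ^ k \<le> x"
    proof (cases k)
      case (Suc l)
      then have "\<not> x < 2 ^ Suc l"
        using not_less_Least[of l "\<lambda>k. x < 2 ^ Suc k"] by (simp add: k_def)
      then show ?thesis using Suc by simp
    qed (use x in auto)
    then show "x \<in> (\<Union>k. B k)" using 1 by (auto simp: B_def)
  next
    fix x :: real assume "x \<in> (\<Union>k. B k)"
    then obtain k where "2 ^ k \<le> x" by (auto simp: B_def)
    moreover have "(1::real) \<le> 2 ^ k" by simp
    ultimately show "x \<in> {1..}" by (meson atLeast_iff order_trans)
  qed
  have disj: "disjoint_family B"
  proof -
    have "B i \<inter> B j = {}" if "i < j" for i j
    proof -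
      have "(2::real) ^ Suc i \<le> 2 ^ j" using that by (intro power_increasing) auto
      then show ?thesis by (auto simp: B_def)
    qed
    then show ?thesis
      unfolding disjoint_family_on_def by (metis Int_commute linorder_neqE_nat)
  qed
  have "(\<integral>\<^sup>+x\<in>{1..}. f x \<partial>lborel) = (\<Sum>k. \<integral>\<^sup>+x\<in>B k. f x \<partial>lborel)"
    unfolding cover by (intro nn_integral_disjoint_family disj) (auto simp: B_def)
  also have "\<dots> = (\<Sum>k. \<integral>\<^sup>+t. 2 ^ k * f (2 ^ k * t) * indicator {1..<2} t \<partial>lborel)"
  proof (intro suminf_cong)
    fix k :: nat
    have [measurable]: "B k \<in> sets borel" by (simp add: B_def)
    have "(\<integral>\<^sup>+x\<in>B k. f x \<partial>lborel)
        = ennreal \<bar>2 ^ k\<bar> * (\<integral>\<^sup>+t. f (0 + 2 ^ k * t) * indicator (B k) (0 + 2 ^ k * t) \<partial>lborel)"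
      by (rule nn_integral_real_affine) auto
    also have "\<dots> = (\<integral>\<^sup>+t. 2 ^ k * (f (2 ^ k * t) * indicator (B k) (2 ^ k * t)) \<partial>lborel)"
      by (subst nn_integral_cmult) (auto simp: ennreal_power[symmetric])
    also have "\<dots> = (\<integral>\<^sup>+t. 2 ^ k * f (2 ^ k * t) * indicator {1..<2} t \<partial>lborel)"
      by (intro nn_integral_cong) (auto simp: B_def indicator_def mult.commute)
    finally show "(\<integral>\<^sup>+x\<in>B k. f x \<partial>lborel)
        = (\<integral>\<^sup>+t. 2 ^ k * f (2 ^ k * t) * indicator {1..<2} t \<partial>lborel)" .
  qed
  also have "\<dots> = (\<integral>\<^sup>+t. (\<Sum>k. 2 ^ k * f (2 ^ k * t) * indicator {1..<2} t) \<partial>lborel)"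
    by (rule nn_integral_suminf[symmetric]) auto
  also have "\<dots> = (\<integral>\<^sup>+t\<in>{1..<2}. (\<Sum>k. 2 ^ k * f (2 ^ k * t)) \<partial>lborel)"
    by (simp add: ennreal_suminf_multc)
  finally show ?thesis .
qed

lemma nn_integral_le_of_dyadic_sums:
  fixes f :: "real \<Rightarrow> ennreal"
  assumes f: "f \<in> borel_measurable borel"
    and bound: "\<And>t N. 1 \<le> t \<Longrightarrow> t < 2 \<Longrightarrow> (\<Sum>k<N. 2 ^ k * f (2 ^ k * t)) \<le> S"
  shows "(\<integral>\<^sup>+x\<in>{1..}. f x \<partial>lborel) \<le> S"
proof -
  have "(\<integral>\<^sup>+x\<in>{1..}. f x \<partial>lborel) \<le> (\<integral>\<^sup>+t\<in>{1..<2::real}. S \<partial>lborel)"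
    unfolding nn_integral_dyadic[OF f]
  proof (intro nn_integral_mono)
    fix t :: real
    show "(\<Sum>k. 2 ^ k * f (2 ^ k * t)) * indicator {1..<2} t \<le> S * indicator {1..<2} t"
      using bound[of t] by (auto simp: indicator_def suminf_eq_SUP intro!: SUP_least)
  qed
  also have "\<dots> = S" by (simp add: nn_integral_cmult_indicator)
  finally show ?thesis .
qed

section \<open>Growth of the kernel on the imaginary axis\<close>

text \<open>
  The pole of a real Moebius transformation lies on the extended real line.
\<close>

lemma moebius_denominator_nonzero:
  assumes "a * d - b * c \<noteq> 0" "Im z \<noteq> 0"
  shows "of_real c * z + of_real d \<noteq> (0::complex)"
proof
  assume *: "of_real c * z + of_real d = (0::complex)"
  from arg_cong[OF *, of Im] assms(2) have "c = 0" by simp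
  with arg_cong[OF *, of Re] have "d = 0" by simp
  with \<open>c = 0\<close> assms(1) show False by simp
qed

lemma moebius_minus_cnj_moebius:
  assumes "a * d - b * c \<noteq> 0" "Im z \<noteq> 0" "Im w \<noteq> 0"
  shows "moebius a b c d z - cnj (moebius a b c d w) =
    of_real (a * d - b * c) * (z - cnj w) /
      ((of_real c * z + of_real d) * cnj (of_real c * w + of_real d))"
proof -
  have "of_real c * z + of_real d \<noteq> (0::complex)"
    using moebius_denominator_nonzero[OF assms(1,2)] .
  moreover have "cnj (of_real c * w + of_real d) \<noteq> 0"
    using moebius_denominator_nonzero[OF assms(1,3)] by (simp only: complex_cnj_zero_iff not_False_eq_True)
  ultimately show ?thesis
    unfolding moebius_def by (simp add: divide_simps) (simp add: algebra_simps)
qed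

lemma Im_moebius:
  assumes "a * d - b * c \<noteq> 0" "Im z \<noteq> 0"
  shows "Im (moebius a b c d z) = (a * d - b * c) * Im z / (cmod (of_real c * z + of_real d))\<^sup>2"
proof -
  let ?D = "of_real c * z + of_real d"
  have "of_real (2 * Im (moebius a b c d z)) * \<i> = moebius a b c d z - cnj (moebius a b c d z)"
    by (simp add: complex_eq_iff)
  also have "\<dots> = of_real (a * d - b * c) * (z - cnj z) / (?D * cnj ?D)"
    by (rule moebius_minus_cnj_moebius[OF assms assms(2)])
  also have "\<dots> = of_real (a * d - b * c) * (of_real (2 * Im z) * \<i>) / of_real ((cmod ?D)\<^sup>2)"
  proof -
    have "z - cnj z = of_real (2 * Im z) * \<i>" by (simp add: complex_eq_iff)
    moreover have "?D * cnj ?D = of_real ((cmod ?D)\<^sup>2)" by (rule complex_norm_square[symmetric])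
    ultimately show ?thesis by (simp only:)
  qed
  also have "\<dots> = of_real (2 * ((a * d - b * c) * Im z / (cmod ?D)\<^sup>2)) * \<i>"
    by simp
  finally show ?thesis
    unfolding mult_cancel_right of_real_eq_iff by simp
qed

text \<open>
  Numerator and denominator are both divided by \<open>\<bar>c z + d\<bar> \<bar>c w + d\<bar>\<close>.
\<close>

lemma moebius_invariant_ratio:
  assumes det: "a * d - b * c = 1" and z: "Im z > 0" and w: "Im w > 0"
  shows "cmod (moebius a b c d z - cnj (moebius a b c d w))
      / sqrt (Im (moebius a b c d z) * Im (moebius a b c d w))
    = cmod (z - cnj w) / sqrt (Im z * Im w)"
proof -
  let ?D = "\<lambda>z. cmod (of_real c * z + of_real d)"
  have det0: "a * d - b * c \<noteq> 0" using det by simp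
  have Dz: "?D z > 0" and Dw: "?D w > 0"
    using moebius_denominator_nonzero[OF det0] z w by auto
  have "cmod (moebius a b c d z - cnj (moebius a b c d w)) = cmod (z - cnj w) / (?D z * ?D w)"
    using z w unfolding moebius_minus_cnj_moebius[OF det0 less_imp_neq[THEN not_sym, OF z] less_imp_neq[THEN not_sym, OF w]]
    by (simp only: norm_divide norm_mult det of_real_1 norm_one mult_1 complex_mod_cnj)
  moreover have "sqrt (Im (moebius a b c d z) * Im (moebius a b c d w)) = sqrt (Im z * Im w) / (?D z * ?D w)"
    using z w Dz Dw by (simp add: Im_moebius[OF det0] det real_sqrt_mult real_sqrt_divide)
  ultimately show ?thesis using Dz Dw z w by simp
qed

text \<open>
  By the open mapping theorem a nonconstant \<open>m\<close> cannot take a real value inside the upper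
  half-plane, since nearby values would have negative imaginary part.
\<close>

lemma nevanlinna_Im_pos:
  assumes m: "nevanlinna m" and z0: "Im z0 > 0" "Im (m z0) > 0" and z: "Im z > 0"
  shows "Im (m z) > 0"
proof (rule ccontr)
  assume neg: "\<not> Im (m z) > 0"
  let ?U = "{z. Im z > 0}"
  have sub: "?U \<subseteq> - \<real>" by (auto simp: complex_is_Real_iff)
  have hol: "m holomorphic_on ?U"
    using m holomorphic_on_subset[OF _ sub] by (auto simp: nevanlinna_def)
  have nn: "\<And>z. Im z > 0 \<Longrightarrow> Im (m z) \<ge> 0" using m by (auto simp: nevanlinna_def)
  have Im0: "Im (m z) = 0" using neg nn[OF z] by simp
  have "\<not> m constant_on ?U"
  proof
    assume "m constant_on ?U"
    then have "m z = m z0" using z z0 by (auto simp: constant_on_def)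
    then show False using Im0 z0 by simp
  qed
  moreover have "open ?U" by (rule open_halfspace_Im_gt)
  moreover have "connected ?U" by (intro convex_connected convex_halfspace_Im_gt)
  ultimately have "open (m ` ?U)"
    using open_mapping_thm[OF hol, of ?U] by auto
  then obtain e where e: "e > 0" "cball (m z) e \<subseteq> m ` ?U"
    using z by (auto simp: open_contains_cball)
  have "m z - \<i> * of_real e \<in> cball (m z) e" using e by (simp add: dist_norm norm_mult)
  then have "m z - \<i> * of_real e \<in> m ` ?U" using e by blast
  then obtain v where "Im v > 0" "m z - \<i> * of_real e = m v" by blast
  moreover from arg_cong[OF this(2), of Im] have "Im (m v) = - e" using Im0 by simp
  ultimately show False using nn[of v] e by simp
qed

lemma bounded_of_tendsto_at_top:
  fixes g :: "real \<Rightarrow> 'a::real_normed_vector"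
  assumes cont: "continuous_on {a..} g" and lim: "(g \<longlongrightarrow> l) at_top"
  obtains B where "B > 0" "\<And>y. y \<ge> a \<Longrightarrow> norm (g y) \<le> B"
proof -
  have "((\<lambda>y. norm (g y)) \<longlongrightarrow> norm l) at_top" by (intro tendsto_norm lim)
  then have "eventually (\<lambda>y. norm (g y) < norm l + 1) at_top"
    by (rule order_tendstoD) simp
  then obtain Y where Y: "\<And>y. y \<ge> Y \<Longrightarrow> norm (g y) < norm l + 1"
    by (auto simp: eventually_at_top_linorder)
  have "compact (g ` {a..Y})"
    by (intro compact_continuous_image continuous_on_subset[OF cont]) auto
  then have "bounded (g ` {a..Y})" by (rule compact_imp_bounded)
  then obtain b where b: "\<And>x. x \<in> g ` {a..Y} \<Longrightarrow> norm x \<le> b"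
    unfolding bounded_iff by metis
  show thesis
  proof (rule that)
    show "max b (norm l + 1) > 0" by (simp add: less_max_iff_disj add_nonneg_pos)
    show "norm (g y) \<le> max b (norm l + 1)" if "y \<ge> a" for y
      using Y[of y] b[of "g y"] that by (cases "y \<ge> Y") (auto simp: le_max_iff_disj)
  qed
qed

lemma neg_imaginary_powr:
  assumes "r > 0"
  shows "(- (of_real r * \<i>)) powr of_real \<alpha> = of_real (r powr \<alpha>) * cis (- (\<alpha> * pi / 2))"
proof -
  have "Ln (- (of_real r * \<i>)) = Ln (of_real r * (- \<i>))" by simp
  also have "\<dots> = of_real (ln r) + Ln (- \<i>)"
    using assms by (subst Ln_times_of_real) (auto simp: Ln_of_real)
  also have "Ln (- \<i>) = - (\<i> * pi / 2)" by (rule Ln_minus_ii)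
  finally have L: "Ln (- (of_real r * \<i>)) = of_real (ln r) + - (\<i> * pi / 2)" .
  have "(- (of_real r * \<i>)) powr of_real \<alpha> = exp (of_real \<alpha> * (of_real (ln r) + - (\<i> * pi / 2)))"
    using assms unfolding powr_def L by simp
  also have "\<dots> = exp (of_real (\<alpha> * ln r)) * exp (\<i> * of_real (- (\<alpha> * pi / 2)))"
    by (subst exp_add[symmetric]) (simp add: algebra_simps)
  also have "\<dots> = of_real (r powr \<alpha>) * cis (- (\<alpha> * pi / 2))"
    using assms by (simp add: powr_def cis_conv_exp flip: exp_of_real)
  finally show ?thesis .
qed

text \<open>
  At \<open>z = i\<close> the model function \<open>C / (- r z)\<^sup>\<alpha>\<close> is exactly \<open>C r\<^sup>-\<^sup>\<alpha> e\<^sup>i\<^sup>\<alpha>\<^sup>\<pi>\<^sup>/\<^sup>2\<close>.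
\<close>

lemma tendsto_on_imaginary_axis:
  fixes n :: "complex \<Rightarrow> complex"
  assumes C: "C > 0"
    and asym: "(\<lambda>r::real. n (of_real r * \<i>)) \<sim>[at_top]
      (\<lambda>r::real. of_real C / (- (of_real r * \<i>)) powr of_real \<alpha>)"
  shows "((\<lambda>y. n (\<i> * of_real y) * of_real (y powr \<alpha>)) \<longlongrightarrow> of_real C * cis (\<alpha> * pi / 2)) at_top"
proof -
  let ?g = "\<lambda>r::real. of_real C / (- (of_real r * \<i>)) powr of_real \<alpha> :: complex"
  let ?L = "of_real C * cis (\<alpha> * pi / 2)"
  have g: "?g r * of_real (r powr \<alpha>) = ?L" "?g r \<noteq> 0" if "r > 0" for r
  proof -
    have inv: "1 / cis (- (\<alpha> * pi / 2)) = cis (\<alpha> * pi / 2)"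
      by (simp only: divide_inverse mult_1 cis_inverse minus_minus)
    have *: "?g r = of_real C / (of_real (r powr \<alpha>) * cis (- (\<alpha> * pi / 2)))"
      by (simp only: neg_imaginary_powr[OF that])
    have "?g r * of_real (r powr \<alpha>) = of_real C * (1 / cis (- (\<alpha> * pi / 2)))"
      unfolding * using that by (simp del: cis_inverse)
    then show "?g r * of_real (r powr \<alpha>) = ?L" unfolding inv .
    show "?g r \<noteq> 0" unfolding * using that C by simp
  qed
  have "((\<lambda>r. n (of_real r * \<i>) / ?g r) \<longlongrightarrow> 1) at_top"
    using asym unfolding asymp_equiv_def
    by (rule tendsto_cong[THEN iffD1, rotated]) (use g(2) in \<open>auto intro!: eventually_mono[OF eventually_gt_at_top[of 0]]\<close>)
  then have "((\<lambda>r. n (of_real r * \<i>) / ?g r * ?L) \<longlongrightarrow> 1 * ?L) at_top"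
    by (intro tendsto_intros)
  then have "((\<lambda>r. n (of_real r * \<i>) / ?g r * ?L) \<longlongrightarrow> ?L) at_top" by simp
  then show ?thesis
  proof (rule tendsto_cong[THEN iffD1, rotated])
    show "\<forall>\<^sub>F r in at_top. n (of_real r * \<i>) / ?g r * ?L = n (\<i> * of_real r) * of_real (r powr \<alpha>)"
      using eventually_gt_at_top[of 0]
    proof eventually_elim
      case (elim r)
      have "n (of_real r * \<i>) / ?g r * (?g r * of_real (r powr \<alpha>)) = n (of_real r * \<i>) * of_real (r powr \<alpha>)"
        using g(2)[OF elim] by (simp only: times_divide_eq_left nonzero_mult_div_cancel_left mult.assoc[symmetric]) simp
      then show ?case unfolding g(1)[OF elim] by (simp only: mult.commute)
    qed
  qed
qed

text \<open>
  With \<open>n = \<mu> \<circ> m\<close>, both \<open>\<bar>n(i y)\<bar>\<close> and \<open>Im n(i y)\<close> are comparable to \<open>y\<^sup>-\<^sup>\<alpha>\<close> on the whole of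
  \<open>[1, \<infinity>)\<close>: for large \<open>y\<close> by the asymptotics, since \<open>Im (e\<^sup>i\<^sup>\<alpha>\<^sup>\<pi>\<^sup>/\<^sup>2) > 0\<close>, and on a remaining compact
  interval because \<open>Im n\<close> is continuous and does not vanish there. Moebius invariance carries the
  resulting bound back to \<open>m\<close>.
\<close>

lemma A_infty_ratio_bound:
  assumes "m \<in> A_infty"
  obtains \<alpha> D :: real where "0 < \<alpha>" "\<alpha> < 1" "D > 0"
    "\<And>y. y > 0 \<Longrightarrow> Im (m (\<i> * of_real y)) > 0"
    "\<And>x y. x \<ge> 1 \<Longrightarrow> y \<ge> 1 \<Longrightarrow>
      cmod (m (\<i> * of_real x) - cnj (m (\<i> * of_real y)))
        / sqrt (Im (m (\<i> * of_real x)) * Im (m (\<i> * of_real y)))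
      \<le> D * ((x powr -\<alpha> + y powr -\<alpha>) / sqrt (x powr -\<alpha> * y powr -\<alpha>))"
proof -
  from assms obtain \<alpha> C a b c d :: real where m: "nevanlinna m" and \<alpha>: "0 < \<alpha>" "\<alpha> < 1"
    and C: "C > 0" and det: "a * d - b * c \<in> {-1, 1}"
    and st: "stieltjes (moebius a b c d \<circ> m)"
    and asym: "\<And>z. z \<in> - \<real> \<Longrightarrow> (\<lambda>r::real. (moebius a b c d \<circ> m) (of_real r * z)) \<sim>[at_top]
          (\<lambda>r::real. of_real C / (- (of_real r * z)) powr of_real \<alpha>)"
    unfolding A_infty_def by blast
  define n where "n = moebius a b c d \<circ> m"
  let ?\<phi> = "\<lambda>y::real. n (\<i> * of_real y) * of_real (y powr \<alpha>)"
  let ?L = "of_real C * cis (\<alpha> * pi / 2)"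
  have det0: "a * d - b * c \<noteq> 0" using det by auto
  have nev: "nevanlinna n" using st by (simp add: stieltjes_def n_def)
  have lim: "(?\<phi> \<longlongrightarrow> ?L) at_top"
    using asym[of \<i>] C by (intro tendsto_on_imaginary_axis) (auto simp: n_def complex_is_Real_iff)
  have "\<alpha> * pi / 2 < pi" using \<alpha> pi_gt_zero by (simp add: mult_less_cancel_right2)
  then have ImL: "Im ?L > 0" using \<alpha> C by (auto intro!: mult_pos_pos sin_gt_zero)
  have limIm: "((\<lambda>y. Im (?\<phi> y)) \<longlongrightarrow> Im ?L) at_top" by (intro tendsto_Im lim)
  have "eventually (\<lambda>y. Im (?\<phi> y) > 0 \<and> y > 0) at_top"
    using order_tendstoD(1)[OF limIm ImL] eventually_gt_at_top[of 0] by (rule eventually_conj)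
  then obtain y0 where y0: "Im (?\<phi> y0) > 0" "y0 > 0"
    by (auto dest: eventually_happens)
  have n0: "Im (n (\<i> * of_real y0)) > 0" using y0 by (simp add: zero_less_mult_iff)
  have m0: "Im (m (\<i> * of_real y0)) \<ge> 0" using m y0 by (auto simp: nevanlinna_def)
  \<comment> \<open>At a point where \<open>Im n\<close> is positive, \<open>Im m\<close> is positive as well, which fixes the sign of the determinant.\<close>
  have m1: "Im (m (\<i> * of_real y0)) \<noteq> 0"
  proof
    assume "Im (m (\<i> * of_real y0)) = 0"
    then have "m (\<i> * of_real y0) = of_real (Re (m (\<i> * of_real y0)))" by (simp add: complex_eq_iff)
    then have "n (\<i> * of_real y0) \<in> \<real>" unfolding n_def moebius_def comp_def
      by (metis Reals_add Reals_divide Reals_mult Reals_of_real)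
    then show False using n0 by (simp add: complex_is_Real_iff)
  qed
  have det1: "a * d - b * c = 1"
    using n0 m0 m1 det by (auto simp: n_def Im_moebius[OF det0 m1] divide_less_0_iff zero_less_divide_iff)
  have mpos: "Im (m (\<i> * of_real y)) > 0" if "y > 0" for y
    using nevanlinna_Im_pos[OF m, of "\<i> * of_real y0" "\<i> * of_real y"] that y0 m0 m1 by auto
  have npos: "Im (n (\<i> * of_real y)) > 0" if "y > 0" for y
    using nevanlinna_Im_pos[OF nev, of "\<i> * of_real y0" "\<i> * of_real y"] that y0 n0 by auto
  have "continuous_on (- \<real>) n" using nev holomorphic_on_imp_continuous_on by (auto simp: nevanlinna_def)
  then have "continuous_on {1..} (\<lambda>y. n (\<i> * of_real y))"
    by (rule continuous_on_compose2) (auto intro!: continuous_intros simp: complex_is_Real_iff)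
  then have cont: "continuous_on {1..} ?\<phi>" by (auto intro!: continuous_intros)
  obtain B where B: "B > 0" "\<And>y. y \<ge> 1 \<Longrightarrow> cmod (?\<phi> y) \<le> B"
    using bounded_of_tendsto_at_top[OF cont lim] by blast
  \<comment> \<open>A positive lower bound for the imaginary part is an upper bound for its reciprocal.\<close>
  have cont': "continuous_on {1..} (\<lambda>y. inverse (Im (?\<phi> y)))"
    using npos by (intro continuous_intros cont) (auto simp: less_le)
  have lim': "((\<lambda>y. inverse (Im (?\<phi> y))) \<longlongrightarrow> inverse (Im ?L)) at_top"
    using ImL by (intro tendsto_inverse limIm less_imp_neq[THEN not_sym])
  obtain A where A: "A > 0" "\<And>y. y \<ge> 1 \<Longrightarrow> norm (inverse (Im (?\<phi> y))) \<le> A"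
    using bounded_of_tendsto_at_top[OF cont' lim'] by blast
  have upper: "cmod (n (\<i> * of_real y)) \<le> B * y powr -\<alpha>" if "y \<ge> 1" for y
    using B(2)[OF that] that by (simp add: norm_mult powr_minus field_simps)
  have lower: "y powr -\<alpha> / A \<le> Im (n (\<i> * of_real y))" if "y \<ge> 1" for y
    using A(2)[OF that] A(1) npos[of y] that by (simp add: powr_minus field_simps)
  show thesis
  proof (rule that[OF \<alpha>])
    show "B * A > 0" using A B by simp
    show "Im (m (\<i> * of_real y)) > 0" if "y > 0" for y by (rule mpos[OF that])
    fix x y :: real assume xy: "x \<ge> 1" "y \<ge> 1"
    let ?x = "n (\<i> * of_real x)" and ?y = "n (\<i> * of_real y)"
    have "cmod (?x - cnj ?y) \<le> B * x powr -\<alpha> + B * y powr -\<alpha>"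
      using norm_triangle_ineq4[of ?x "cnj ?y"] upper[OF xy(1)] upper[OF xy(2)] by simp
    moreover have "sqrt (x powr -\<alpha> * y powr -\<alpha>) / A \<le> sqrt (Im ?x * Im ?y)"
    proof -
      have "sqrt (x powr -\<alpha> * y powr -\<alpha>) / A = sqrt ((x powr -\<alpha> / A) * (y powr -\<alpha> / A))"
        using A by (simp add: real_sqrt_divide real_sqrt_mult)
      also have "\<dots> \<le> sqrt (Im ?x * Im ?y)"
        using lower[OF xy(1)] lower[OF xy(2)] npos[of x] npos[of y] xy A
        by (intro real_sqrt_le_mono mult_mono) auto
      finally show ?thesis .
    qed
    ultimately have "cmod (?x - cnj ?y) / sqrt (Im ?x * Im ?y)
        \<le> (B * x powr -\<alpha> + B * y powr -\<alpha>) / (sqrt (x powr -\<alpha> * y powr -\<alpha>) / A)"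
      using xy A B by (intro frac_le) (auto intro!: add_nonneg_nonneg)
    also have "\<dots> = B * A * ((x powr -\<alpha> + y powr -\<alpha>) / sqrt (x powr -\<alpha> * y powr -\<alpha>))"
      by (simp add: field_simps)
    finally show "cmod (m (\<i> * of_real x) - cnj (m (\<i> * of_real y)))
        / sqrt (Im (m (\<i> * of_real x)) * Im (m (\<i> * of_real y)))
      \<le> B * A * ((x powr -\<alpha> + y powr -\<alpha>) / sqrt (x powr -\<alpha> * y powr -\<alpha>))"
      using moebius_invariant_ratio[OF det1, of "m (\<i> * of_real x)" "m (\<i> * of_real y)"] mpos xy
      by (simp add: n_def)
  qed
qed

text \<open>
  With \<open>\<theta> = y / x \<le> 1\<close> the first factor is at most \<open>\<theta>\<^sup>1\<^sup>/\<^sup>2\<close>, and the second is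
  \<open>\<theta>\<^sup>\<alpha>\<^sup>/\<^sup>2 + \<theta>\<^sup>-\<^sup>\<alpha>\<^sup>/\<^sup>2 \<le> 2 \<theta>\<^sup>-\<^sup>\<alpha>\<^sup>/\<^sup>2\<close>.
\<close>

lemma power_kernel_decay:
  fixes x y \<alpha> :: real
  assumes y: "0 < y" and yx: "y \<le> x" and \<alpha>: "0 < \<alpha>"
  shows "sqrt (x * y) / (x + y) * ((x powr -\<alpha> + y powr -\<alpha>) / sqrt (x powr -\<alpha> * y powr -\<alpha>))
    \<le> 2 * (y / x) powr ((1 - \<alpha>) / 2)"
proof -
  have x: "x > 0" using y yx by simp
  have "x powr -\<alpha> \<le> y powr -\<alpha>" using y yx \<alpha> by (intro powr_mono2') auto
  then have "sqrt (x * y) / (x + y) * ((x powr -\<alpha> + y powr -\<alpha>) / sqrt (x powr -\<alpha> * y powr -\<alpha>))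
    \<le> sqrt (x * y) / x * (2 * y powr -\<alpha> / sqrt (x powr -\<alpha> * y powr -\<alpha>))"
    using x y by (intro mult_mono frac_le) (auto intro!: add_nonneg_nonneg)
  also have "\<dots> = 2 * (y / x) powr ((1 - \<alpha>) / 2)"
  proof -
    have sqrt_exp: "sqrt (exp u) = exp (u / 2)" for u :: real
      by (rule real_sqrt_unique) (simp_all add: power2_eq_square flip: exp_add)
    \<comment> \<open>In logarithmic coordinates the identity is linear in the exponents.\<close>
    obtain a b where ab: "x = exp a" "y = exp b"
      using x y by (metis exp_ln)
    have "sqrt (x * y) / x = exp ((a + b) / 2 - a)"
      by (simp only: ab sqrt_exp flip: exp_add exp_diff)
    moreover have "y powr -\<alpha> / sqrt (x powr -\<alpha> * y powr -\<alpha>) = exp (-\<alpha> * b - (-\<alpha> * a + -\<alpha> * b) / 2)"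
      using x y by (simp only: ab powr_def exp_not_eq_zero if_False ln_exp sqrt_exp flip: exp_add exp_diff)
    ultimately have "sqrt (x * y) / x * (2 * y powr -\<alpha> / sqrt (x powr -\<alpha> * y powr -\<alpha>))
        = 2 * exp ((a + b) / 2 - a + (-\<alpha> * b - (-\<alpha> * a + -\<alpha> * b) / 2))"
      by (simp only: exp_add times_divide_eq_right[symmetric] mult.left_commute)
    also have "(a + b) / 2 - a + (-\<alpha> * b - (-\<alpha> * a + -\<alpha> * b) / 2) = (1 - \<alpha>) / 2 * (b - a)"
      by (simp add: field_simps)
    also have "exp ((1 - \<alpha>) / 2 * (b - a)) = (y / x) powr ((1 - \<alpha>) / 2)"
      by (simp add: powr_def ab flip: exp_diff)
    finally show ?thesis .
  qed
  finally show ?thesis .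
qed

text \<open>
  The exponent is \<open>|j - k|\<close>; each side of the diagonal contributes at most one geometric series.
\<close>

lemma sum_power_distance_le:
  fixes \<rho> :: real
  assumes "0 \<le> \<rho>" "\<rho> < 1"
  shows "(\<Sum>k<N. \<rho> ^ (max j k - min j k)) \<le> 2 / (1 - \<rho>)"
proof -
  have geom: "(\<Sum>k\<in>I. \<rho> ^ k) \<le> 1 / (1 - \<rho>)" if "finite I" for I
    using sum_le_suminf[of "(^) \<rho>" I] that assms by (simp add: suminf_geometric)
  have "(\<Sum>k<N. \<rho> ^ (max j k - min j k)) \<le> (\<Sum>k\<in>{..<N} \<union> {..j}. \<rho> ^ (max j k - min j k))"
    using assms by (intro sum_mono2) auto
  also have "\<dots> = (\<Sum>k\<le>j. \<rho> ^ (j - k)) + (\<Sum>k\<in>{j<..<N}. \<rho> ^ (k - j))"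
  proof -
    have "{..<N} \<union> {..j} = {..j} \<union> {j<..<N}" by auto
    then show ?thesis
      by (simp only:, subst sum.union_disjoint) (auto intro!: arg_cong2[where f="(+)"] sum.cong simp: max_def min_def)
  qed
  also have "(\<Sum>k\<le>j. \<rho> ^ (j - k)) = (\<Sum>k\<in>(\<lambda>k. j - k) ` {..j}. \<rho> ^ k)"
    by (subst sum.reindex) (auto simp: inj_on_def)
  also have "(\<Sum>k\<in>{j<..<N}. \<rho> ^ (k - j)) = (\<Sum>k\<in>(\<lambda>k. k - j) ` {j<..<N}. \<rho> ^ k)"
    by (subst sum.reindex) (auto simp: inj_on_def)
  also have "(\<Sum>k\<in>(\<lambda>k. j - k) ` {..j}. \<rho> ^ k) + (\<Sum>k\<in>(\<lambda>k. k - j) ` {j<..<N}. \<rho> ^ k) \<le> 1 / (1 - \<rho>) + 1 / (1 - \<rho>)"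
    by (intro add_mono geom) auto
  finally show ?thesis by simp
qed

section \<open>The restriction operator\<close>

text \<open>
  The masses \<open>2\<^sup>k t\<close> make the matrix scale invariant: \<open>sqrt (x y) / (x + y)\<close> depends on \<open>x / y\<close>
  only, and at \<open>x = 2\<^sup>j t\<close>, \<open>y = 2\<^sup>k t\<close> the \<open>(j, k)\<close> entry is bounded by a multiple of \<open>\<rho>\<^bsup>|j - k|\<^esup>\<close>
  with \<open>\<rho> = 2\<^bsup>-(1 - \<alpha>)/2\<^esup>\<close>, which is less than \<open>1\<close> because \<open>\<alpha> < 1\<close>.
\<close>

lemma dyadic_row_sums_bounded:
  assumes "m \<in> A_infty"
  obtains S where "S \<ge> 0"
    "\<And>t j N. 1 \<le> t \<Longrightarrow> (\<Sum>k<N. sqrt ((2 ^ j * t * B_weight m (2 ^ j * t)) * (2 ^ k * t * B_weight m (2 ^ k * t)))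
        * cmod (nevanlinna_kernel m (\<i> * of_real (2 ^ j * t)) (\<i> * of_real (2 ^ k * t)))) \<le> S"
proof -
  obtain \<alpha> D :: real where \<alpha>: "0 < \<alpha>" "\<alpha> < 1" and D: "D > 0"
    and pos: "\<And>y. y > 0 \<Longrightarrow> Im (m (\<i> * of_real y)) > 0"
    and ratio: "\<And>x y. x \<ge> 1 \<Longrightarrow> y \<ge> 1 \<Longrightarrow>
      cmod (m (\<i> * of_real x) - cnj (m (\<i> * of_real y)))
        / sqrt (Im (m (\<i> * of_real x)) * Im (m (\<i> * of_real y)))
      \<le> D * ((x powr -\<alpha> + y powr -\<alpha>) / sqrt (x powr -\<alpha> * y powr -\<alpha>))"
    using A_infty_ratio_bound[OF assms] by blast
  define \<rho> where "\<rho> = (1 / 2 :: real) powr ((1 - \<alpha>) / 2)"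
  have \<rho>: "0 < \<rho>" "\<rho> < 1"
    using \<alpha> powr_less_mono2[of "(1 - \<alpha>) / 2" "1 / 2" 1] by (auto simp: \<rho>_def)
  have entry: "sqrt ((x * B_weight m x) * (y * B_weight m y))
        * cmod (nevanlinna_kernel m (\<i> * of_real x) (\<i> * of_real y))
      \<le> D * (sqrt (x * y) / (x + y) * ((x powr -\<alpha> + y powr -\<alpha>) / sqrt (x powr -\<alpha> * y powr -\<alpha>)))"
    if xy: "x \<ge> 1" "y \<ge> 1" for x y
  proof -
    have "\<i> * of_real x - cnj (\<i> * of_real y) = \<i> * of_real (x + y)"
      by (simp add: algebra_simps)
    moreover have "\<i> * of_real x \<noteq> cnj (\<i> * of_real y)"
      using xy by (auto simp: complex_eq_iff)
    ultimately have "cmod (nevanlinna_kernel m (\<i> * of_real x) (\<i> * of_real y))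
        = cmod (m (\<i> * of_real x) - cnj (m (\<i> * of_real y))) / (x + y)"
      using xy by (simp add: nevanlinna_kernel_def norm_divide norm_mult del: of_real_add)
    then have "sqrt ((x * B_weight m x) * (y * B_weight m y))
        * cmod (nevanlinna_kernel m (\<i> * of_real x) (\<i> * of_real y))
      = sqrt (x * y) / (x + y) * (cmod (m (\<i> * of_real x) - cnj (m (\<i> * of_real y)))
        / sqrt (Im (m (\<i> * of_real x)) * Im (m (\<i> * of_real y))))"
      by (simp add: B_weight_def real_sqrt_mult real_sqrt_divide)
    also have "\<dots> \<le> sqrt (x * y) / (x + y) * (D * ((x powr -\<alpha> + y powr -\<alpha>) / sqrt (x powr -\<alpha> * y powr -\<alpha>)))"
      using xy by (intro mult_left_mono ratio) auto
    finally show ?thesis by (simp only: mult_ac)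
  qed
  have decay: "sqrt (x * y) / (x + y) * ((x powr -\<alpha> + y powr -\<alpha>) / sqrt (x powr -\<alpha> * y powr -\<alpha>))
      \<le> 2 * \<rho> ^ (max j k - min j k)"
    if t: "1 \<le> t" and xy: "x = 2 ^ j * t" "y = 2 ^ k * t" for x y t j k
  proof -
    have main: "sqrt (x * y) / (x + y) * ((x powr -\<alpha> + y powr -\<alpha>) / sqrt (x powr -\<alpha> * y powr -\<alpha>))
      \<le> 2 * \<rho> ^ (j - k)" if kj: "k \<le> j" and xy: "x = 2 ^ j * t" "y = 2 ^ k * t" for x y j k
    proof -
      have "y / x = (1 / 2) ^ (j - k)"
        using t kj by (simp add: xy power_diff power_divide)
      then have "(y / x) powr ((1 - \<alpha>) / 2) = ((1 / 2) powr real (j - k)) powr ((1 - \<alpha>) / 2)"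
        by (simp only: powr_realpow zero_less_divide_1_iff zero_less_numeral)
      also have "\<dots> = \<rho> powr real (j - k)"
        by (simp add: \<rho>_def powr_powr mult.commute)
      also have "\<dots> = \<rho> ^ (j - k)" using \<rho> by (simp add: powr_realpow)
      finally have "(y / x) powr ((1 - \<alpha>) / 2) = \<rho> ^ (j - k)" .
      moreover have "0 < y" "y \<le> x" using t kj by (auto simp: xy)
      ultimately show ?thesis using power_kernel_decay[of y x \<alpha>] \<alpha> by simp
    qed
    show ?thesis
    proof (cases "k \<le> j")
      case True
      then show ?thesis using main[OF True xy] by (simp only: max_absorb1 min_absorb2)
    next
      case False
      then have "j \<le> k" by simp
      then show ?thesis
        using main[OF \<open>j \<le> k\<close> xy(2,1)] by (simp only: max_absorb2 min_absorb1 mult.commute add.commute)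
    qed
  qed
  show thesis
  proof (rule that)
    show "D * (2 * (2 / (1 - \<rho>))) \<ge> 0" using D \<rho> by simp
    fix t :: real and j N :: nat assume t: "1 \<le> t"
    have ge1: "2 ^ k * t \<ge> 1" for k using t mult_mono[of 1 "2 ^ k" 1 t] by simp
    have "(\<Sum>k<N. sqrt ((2 ^ j * t * B_weight m (2 ^ j * t)) * (2 ^ k * t * B_weight m (2 ^ k * t)))
        * cmod (nevanlinna_kernel m (\<i> * of_real (2 ^ j * t)) (\<i> * of_real (2 ^ k * t))))
      \<le> (\<Sum>k<N. D * (2 * \<rho> ^ (max j k - min j k)))"
      using D by (intro sum_mono order_trans[OF entry[OF ge1 ge1]] mult_left_mono decay[OF t refl refl]) auto
    also have "\<dots> \<le> D * (2 * (2 / (1 - \<rho>)))"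
      unfolding sum_distrib_left[symmetric] using D \<rho>
      by (intro mult_left_mono sum_power_distance_le) auto
    finally show "(\<Sum>k<N. sqrt ((2 ^ j * t * B_weight m (2 ^ j * t)) * (2 ^ k * t * B_weight m (2 ^ k * t)))
        * cmod (nevanlinna_kernel m (\<i> * of_real (2 ^ j * t)) (\<i> * of_real (2 ^ k * t))))
      \<le> D * (2 * (2 / (1 - \<rho>)))" .
  qed
qed

theorem corollary3p10:
  fixes m :: "complex \<Rightarrow> complex"
  assumes "m \<in> A_infty"
  shows "has_B_infty_property m"
  unfolding has_B_infty_property_def
proof (intro allI impI)
  fix H ip assume sp: "nevanlinna_space m H ip"
  then interpret rkhs "- \<real>" "nevanlinna_kernel m" H ip by (simp add: nevanlinna_space_def)
  have hol: "\<And>h. h \<in> H \<Longrightarrow> h holomorphic_on (- \<real>)" using sp by (simp add: nevanlinna_space_def)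
  obtain S where S: "S \<ge> 0" and row:
    "\<And>t j N. 1 \<le> t \<Longrightarrow> (\<Sum>k<N. sqrt ((2 ^ j * t * B_weight m (2 ^ j * t)) * (2 ^ k * t * B_weight m (2 ^ k * t)))
        * cmod (nevanlinna_kernel m (\<i> * of_real (2 ^ j * t)) (\<i> * of_real (2 ^ k * t)))) \<le> S"
    using dyadic_row_sums_bounded[OF assms] by blast
  have Im_pos: "\<And>y. y > 0 \<Longrightarrow> Im (m (\<i> * of_real y)) > 0"
    using A_infty_ratio_bound[OF assms] by metis
  have w0: "B_weight m y > 0" if "y > 0" for y using Im_pos[OF that] by (simp add: B_weight_def)
  have axis: "continuous_on {1<..} (\<lambda>y::real. h (\<i> * of_real y))"
    if "h holomorphic_on (- \<real>)" for h :: "complex \<Rightarrow> complex"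
    using holomorphic_on_imp_continuous_on[OF that]
    by (rule continuous_on_compose2) (auto intro!: continuous_intros simp: complex_is_Real_iff)
  have "m holomorphic_on (- \<real>)" using assms by (simp add: A_infty_def nevanlinna_def)
  then have w_cont: "continuous_on {1<..} (B_weight m)"
    unfolding B_weight_def using Im_pos by (intro continuous_intros axis) (auto simp: less_le)
  show "\<exists>M. \<forall>h\<in>H. (\<lambda>y. h (\<i> * of_real y)) \<in> L2_weighted (B_weight m) {1<..} \<and>
      L2_weighted_norm (B_weight m) {1<..} (\<lambda>y. h (\<i> * of_real y)) \<le> M * sqrt (Re (ip h h))"
  proof (intro exI ballI)
    fix h assume h: "h \<in> H"
    define F where "F = (\<lambda>y. indicator {1<..} y *\<^sub>R ((cmod (h (\<i> * of_real y)))\<^sup>2 * B_weight m y))"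
    have h_meas: "set_borel_measurable lborel {1<..} (\<lambda>y. h (\<i> * of_real y))"
      unfolding set_borel_measurable_def
      using borel_measurable_continuous_on_indicator[OF _ axis[OF hol[OF h]]] by simp
    have F_meas [measurable]: "F \<in> borel_measurable borel"
      unfolding F_def
      by (rule borel_measurable_continuous_on_indicator) (auto intro!: continuous_intros axis hol h w_cont)
    have F0: "F y \<ge> 0" for y using w0[of y] by (auto simp: F_def indicator_def)
    have dyadic: "(\<Sum>k<N. 2 ^ k * F (2 ^ k * t)) \<le> S * Re (ip h h)" if t: "1 \<le> t" for t N
    proof -
      have "(\<Sum>k<N. 2 ^ k * F (2 ^ k * t))
          \<le> (\<Sum>k<N. 2 ^ k * t * B_weight m (2 ^ k * t) * (cmod (h (\<i> * of_real (2 ^ k * t))))\<^sup>2)"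
      proof (intro sum_mono)
        fix k
        define G where "G = B_weight m (2 ^ k * t) * (cmod (h (\<i> * of_real (2 ^ k * t))))\<^sup>2"
        have G: "G \<ge> 0" using w0[of "2 ^ k * t"] t by (simp add: G_def)
        have "F (2 ^ k * t) \<le> G"
          using G by (auto simp: F_def G_def indicator_def mult.commute)
        \<comment> \<open>Since \<open>t \<ge> 1\<close>, the mass \<open>2\<^sup>k\<close> of the dyadic sum may be enlarged to the scale-invariant \<open>2\<^sup>k t\<close>.\<close>
        also have "\<dots> \<le> t * G" using mult_right_mono[OF t G] by simp
        finally have "2 ^ k * F (2 ^ k * t) \<le> 2 ^ k * (t * G)" by (intro mult_left_mono) auto
        then show "2 ^ k * F (2 ^ k * t)
            \<le> 2 ^ k * t * B_weight m (2 ^ k * t) * (cmod (h (\<i> * of_real (2 ^ k * t))))\<^sup>2"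
          by (simp only: G_def mult.assoc)
      qed
      also have "\<dots> \<le> S * Re (ip h h)"
      proof (rule sampling_bound_schur[OF finite_lessThan _ _ row[OF t] S h])
        show "\<i> * of_real (2 ^ k * t) \<in> - \<real>" for k using t by (simp add: complex_is_Real_iff)
        show "0 \<le> 2 ^ k * t * B_weight m (2 ^ k * t)" for k
          using t w0[of "2 ^ k * t"] by simp
      qed
      finally show ?thesis .
    qed
    have "(\<integral>\<^sup>+y. ennreal (F y) \<partial>lborel) = (\<integral>\<^sup>+y\<in>{1..}. ennreal (F y) \<partial>lborel)"
      by (intro nn_integral_cong) (auto simp: F_def indicator_def)
    also have "\<dots> \<le> ennreal (S * Re (ip h h))"
    proof (rule nn_integral_le_of_dyadic_sums)
      fix t :: real and N :: nat assume t: "1 \<le> t"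
      have "(\<Sum>k<N. 2 ^ k * ennreal (F (2 ^ k * t))) = (\<Sum>k<N. ennreal (2 ^ k * F (2 ^ k * t)))"
        using F0 by (intro sum.cong refl) (simp add: ennreal_mult ennreal_power[symmetric])
      also have "\<dots> = ennreal (\<Sum>k<N. 2 ^ k * F (2 ^ k * t))"
        using F0 by (intro sum_ennreal) auto
      also have "\<dots> \<le> ennreal (S * Re (ip h h))" by (intro ennreal_leI dyadic t)
      finally show "(\<Sum>k<N. 2 ^ k * ennreal (F (2 ^ k * t))) \<le> ennreal (S * Re (ip h h))" .
    qed measurable
    finally have nn: "(\<integral>\<^sup>+y. ennreal (F y) \<partial>lborel) \<le> ennreal (S * Re (ip h h))" .
    have int: "integrable lborel F"
      using nn F0 by (intro integrableI_nonneg) (auto simp: top_unique less_top[symmetric])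
    have "integral\<^sup>L lborel F \<le> S * Re (ip h h)"
    proof -
      have "ennreal (integral\<^sup>L lborel F) \<le> ennreal (S * Re (ip h h))"
        using nn nn_integral_eq_integral[OF int] F0 by simp
      then show ?thesis using S Re_ip_self_nonneg[OF h] by simp
    qed
    then have "sqrt (integral\<^sup>L lborel F) \<le> sqrt S * sqrt (Re (ip h h))"
      by (metis real_sqrt_le_mono real_sqrt_mult)
    then show "(\<lambda>y. h (\<i> * of_real y)) \<in> L2_weighted (B_weight m) {1<..} \<and>
      L2_weighted_norm (B_weight m) {1<..} (\<lambda>y. h (\<i> * of_real y)) \<le> sqrt S * sqrt (Re (ip h h))"
      using int h_meas
      by (simp add: L2_weighted_def L2_weighted_norm_def set_integrable_def set_lebesgue_integral_def F_def)
  qed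
qed

end
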